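(* Let $n\ge 1$, let $T>0$, let $G \in \mathcal{G}^n$ be a graph, let $X \in \mathcal{Q}(G)$ and $x_0 \in \mathbb{R}^{n}$, and define $$P := \int_0^{T} e^{Xt} x_0 x_0^\top e^{Xt}\, dt, \qquad Q := x_T x_T^\top - x_0 x_0^\top, \qquad x_T := e^{XT}x_0.$$ Then the network reconstruction problem is solvable for $(x_0,X,\mathcal{Q})$ if and only if the Lyapunov equation $SP + PS = Q$ admits a unique solution $S\in\mathbb{R}^{n\times n}$. Under this condition, we have $S = X$.
   Context: $\mathbb{S}^n$ is the set of real symmetric $n\times n$ matrices. $\mathcal{G}^n$ is the set of simple undirected graphs (no self-loops, at most one edge between any pair of vertices) with vertex set $V=\{1,\dots,n\}$. For $G\in\mathcal{G}^n$ with edge set $E$, the qualitative class is $\mathcal{Q}(G) := \{X \in \mathbb{S}^n \mid \text{for all } i \neq j,\ X_{ij} \neq 0 \iff (i,j) \in E\}$; this defines a set-valued map $\mathcal{Q}:\mathcal{G}^n\to 2^{\mathbb{S}^n}$. The image of a set-valued map $\mathcal{K} : \mathcal{G}^n \to 2^{\mathbb{S}^n}$ is $\operatorname{im}\mathcal{K} := \{Y \in \mathbb{S}^n \mid \exists\, G\in\mathcal{G}^n \text{ such that } Y \in \mathcal{K}(G)\}$. Solvability: for $x_0\in\mathbb{R}^n$ and $X\in\operatorname{im}\mathcal{K}$, let $x_{x_0}(t)=e^{Xt}x_0$ be the solution of $\dot x(t)=Xx(t)$ for $t\ge 0$, $x(0)=x_0$. The network reconstruction problem is said to be solvable for $(x_0,X,\mathcal{K})$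 if for every $\bar X\in\operatorname{im}\mathcal{K}$ such that $x_{x_0}(\cdot)$ is a solution to $\dot x(t)=\bar X x(t)$ for $t\in[0,T]$, we have $\bar X=X$. Here $T>0$ is a fixed real number (the same $T$ as in the definition of $P$ and $Q$). *)

theory Defs
  imports "HOL-Analysis.Analysis" "Graph_Theory.Pair_Digraph"
begin

definition sym_matrices :: "(real^'n^'n) set" where
  "sym_matrices = {X. transpose X = X}"

text \<open>
  The index type \<open>'n\<close> plays the role of the vertex set \<open>{1,\<dots>,n}\<close>, with \<open>n = CARD('n)\<close>.
  An undirected edge \<open>{i,j}\<close> is represented by the two arcs \<open>(i,j)\<close> and \<open>(j,i)\<close>;
  the locale \<^locale>\<open>pair_graph\<close> demands symmetry and the absence of loops.
\<close>

definition simple_graphs :: "'n::finite pair_pre_digraph set" where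
  "simple_graphs = {G. pair_graph G \<and> pverts G = UNIV}"

definition qual_class :: "'n::finite pair_pre_digraph \<Rightarrow> (real^'n^'n) set" where
  "qual_class G = {X \<in> sym_matrices. \<forall>i j. i \<noteq> j \<longrightarrow> (X $ i $ j \<noteq> 0 \<longleftrightarrow> (i, j) \<in> parcs G)}"

definition im_graph_map :: "('n::finite pair_pre_digraph \<Rightarrow> (real^'n^'n) set) \<Rightarrow> (real^'n^'n) set" where
  "im_graph_map K = {Y \<in> sym_matrices. \<exists>G\<in>simple_graphs. Y \<in> K G}"

text \<open>
  The type \<^typ>\<open>real^'n^'n\<close> carries componentwise multiplication and is not an instance of
  the class on which \<^const>\<open>exp\<close> is defined, so the matrix exponential is given by its
  power series with respect to the matrix product.
\<close>

definition mat_exp :: "real^'n^'n \<Rightarrow> real^'n^'n" where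
  "mat_exp A = (\<Sum>k. (1 / fact k) *\<^sub>R ((((**) A) ^^ k) (mat 1)))"

definition outer_prod :: "real^'n \<Rightarrow> real^'n \<Rightarrow> real^'n^'n" where
  "outer_prod x y = (\<chi> i j. x $ i * y $ j)"

definition trajectory :: "real^'n^'n \<Rightarrow> real^'n \<Rightarrow> real \<Rightarrow> real^'n" where
  "trajectory X x0 t = mat_exp (t *\<^sub>R X) *v x0"

definition solves_on :: "real \<Rightarrow> real^'n^'n \<Rightarrow> (real \<Rightarrow> real^'n) \<Rightarrow> bool" where
  "solves_on T A x \<longleftrightarrow> (\<forall>t\<in>{0..T}. (x has_vector_derivative A *v x t) (at t within {0..T}))"

text \<open>Only meaningful for \<open>T > 0\<close> and \<open>X \<in> im_graph_map K\<close>.\<close>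

definition reconstruction_solvable ::
  "real \<Rightarrow> real^'n \<Rightarrow> real^'n^'n \<Rightarrow> ('n::finite pair_pre_digraph \<Rightarrow> (real^'n^'n) set) \<Rightarrow> bool" where
  "reconstruction_solvable T x0 X K \<longleftrightarrow>
    (\<forall>Xb\<in>im_graph_map K. solves_on T Xb (trajectory X x0) \<longrightarrow> Xb = X)"

end

theory Submission
  imports Defs
begin

text \<open>
  Put \<open>x(t) = e\<^bsup>tX\<^esup> x\<^sub>0\<close>. As \<open>X\<close> is symmetric, \<open>P = \<integral> x x\<^sup>T\<close>, and integrating
  \<open>(x x\<^sup>T)' = X x x\<^sup>T + x x\<^sup>T X\<close> shows that \<open>X\<close> solves the Lyapunov equation.
  Every symmetric matrix has a pattern, so solvability says that the only symmetric \<open>D\<close> with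
  \<open>D x(t) = 0\<close> on \<open>[0,T]\<close> is \<open>D = 0\<close>. Such a \<open>D\<close> satisfies \<open>D P = P D = 0\<close>, hence uniqueness
  implies solvability. Conversely, \<open>v\<^sup>T P v = \<integral> (v\<^sup>T x)\<^sup>2 = 0\<close> gives \<open>D x = 0\<close> for \<open>D = v v\<^sup>T\<close>, so
  solvability makes \<open>P\<close> positive definite, and then \<open>S P + P S = 0\<close> forces \<open>S = 0\<close>, by taking
  the trace of \<open>S\<^sup>T S P + S\<^sup>T P S\<close>.
\<close>

section \<open>Entries, derivative and transpose of the matrix exponential\<close>

lemma matrix_power_scaleR:
  fixes A B :: "real^'n^'n"
  shows "(((**) (t *\<^sub>R A)) ^^ k) B = t ^ k *\<^sub>R ((((**) A) ^^ k) B)"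
  by (induction k)
     (simp_all add: matrix_matrix_mult_def vec_eq_iff sum_distrib_left mult_ac)

lemma bounded_linear_matrix_mult_left: "bounded_linear (\<lambda>B::real^'n^'n. A ** B)"
  unfolding linear_conv_bounded_linear[symmetric]
  by (intro linearI) (simp_all add: matrix_matrix_mult_def vec_eq_iff sum.distrib distrib_left
      sum_distrib_left mult_ac)

lemma bounded_linear_matrix_mult_right: "bounded_linear (\<lambda>B::real^'n^'n. B ** A)"
  unfolding linear_conv_bounded_linear[symmetric]
  by (intro linearI) (simp_all add: matrix_matrix_mult_def vec_eq_iff sum.distrib distrib_right distrib_left
      sum_distrib_left mult_ac)

text \<open>Left multiplication by \<open>A\<close> is bounded by some \<open>K\<close>, so the
  powers of \<open>A\<close> grow at most geometrically and the exponential series of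
  \<open>K\<close> dominates.\<close>

lemma summable_mat_exp:
  fixes A :: "real^'n^'n"
  shows "summable (\<lambda>k. (1 / fact k) *\<^sub>R ((((**) A) ^^ k) (mat 1)))"
proof -
  obtain K where K: "K > 0" "\<And>B::real^'n^'n. norm (A ** B) \<le> norm B * K"
    using bounded_linear.pos_bounded[OF bounded_linear_matrix_mult_left, of A] by blast
  define c where "c = norm (mat 1 :: real^'n^'n)"
  have bound: "norm ((((**) A) ^^ k) (mat 1)) \<le> c * K ^ k" for k
  proof (induction k)
    case (Suc k)
    have "norm ((((**) A) ^^ Suc k) (mat 1)) \<le> norm ((((**) A) ^^ k) (mat 1)) * K"
      by (simp add: K)
    also have "\<dots> \<le> (c * K ^ k) * K"
      using Suc K(1) by (intro mult_right_mono) auto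
    finally show ?case by (simp add: mult_ac)
  qed (simp add: c_def)
  have "summable (\<lambda>k. c * (inverse (fact k) * K ^ k))"
    by (intro summable_mult summable_exp)
  moreover have "norm ((1 / fact k) *\<^sub>R ((((**) A) ^^ k) (mat 1)))
      \<le> c * (inverse (fact k) * K ^ k)" for k
    using bound[of k] by (simp add: field_simps)
  ultimately show ?thesis
    by (rule summable_comparison_test'[where N = 0])
qed

text \<open>Entrywise, the exponential is a real power series in \<open>t\<close>, which opens the
  way to termwise differentiation.\<close>

lemma mat_exp_nth_sums:
  fixes A :: "real^'n^'n"
  shows "(\<lambda>k. ((((**) A) ^^ k) (mat 1)) $ i $ j / fact k * t ^ k) sums (mat_exp (t *\<^sub>R A) $ i $ j)"
proof -
  have "(\<lambda>k. (1 / fact k) *\<^sub>R ((((**) (t *\<^sub>R A)) ^^ k) (mat 1))) sums mat_exp (t *\<^sub>R A)"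
    unfolding mat_exp_def by (rule summable_sums[OF summable_mat_exp])
  then have "(\<lambda>k. ((1 / fact k) *\<^sub>R ((((**) (t *\<^sub>R A)) ^^ k) (mat 1))) $ i $ j)
      sums (mat_exp (t *\<^sub>R A) $ i $ j)"
    by (intro bounded_linear.sums[OF bounded_linear_vec_nth])
  then show ?thesis
    by (simp add: matrix_power_scaleR mult_ac)
qed

lemma mat_exp_nth_has_derivative:
  fixes A :: "real^'n^'n"
  shows "((\<lambda>t. mat_exp (t *\<^sub>R A) $ i $ j) has_real_derivative (A ** mat_exp (t *\<^sub>R A)) $ i $ j) (at t)"
proof -
  define c where "c k = ((((**) A) ^^ k) (mat 1)) $ i $ j / fact k" for k
  have "((\<lambda>t. \<Sum>k. c k * t ^ k) has_real_derivative (\<Sum>k. diffs c k * t ^ k)) (at t)"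
    by (rule termdiffs_strong_converges_everywhere)
       (use mat_exp_nth_sums[of A i j] in \<open>auto simp: c_def sums_iff\<close>)
  moreover have "(\<Sum>k. c k * t ^ k) = mat_exp (t *\<^sub>R A) $ i $ j" for t
    using mat_exp_nth_sums[of A i j t] by (simp add: c_def sums_iff)
  moreover have "(\<Sum>k. diffs c k * t ^ k) = (A ** mat_exp (t *\<^sub>R A)) $ i $ j"
  proof -
    have "(\<lambda>k. \<Sum>l\<in>UNIV. A $ i $ l * (((((**) A) ^^ k) (mat 1)) $ l $ j / fact k * t ^ k))
        sums (\<Sum>l\<in>UNIV. A $ i $ l * mat_exp (t *\<^sub>R A) $ l $ j)"
      by (intro sums_sum sums_mult mat_exp_nth_sums)
    moreover have "diffs c k * t ^ k
        = (\<Sum>l\<in>UNIV. A $ i $ l * (((((**) A) ^^ k) (mat 1)) $ l $ j / fact k * t ^ k))" for k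
    proof -
      \<comment> \<open>\<open>diffs\<close> brings down the factor \<open>Suc k\<close>, which
        cancels against \<open>fact (Suc k)\<close>; the shifted index leaves one extra
        \<open>A\<close> on the left.\<close>
      have "diffs c k = (A ** (((**) A) ^^ k) (mat 1)) $ i $ j / fact k"
        by (simp add: diffs_def c_def divide_simps del: of_nat_Suc)
      then show ?thesis
        by (simp add: matrix_matrix_mult_def sum_distrib_right sum_divide_distrib mult.assoc)
    qed
    ultimately show ?thesis
      by (simp add: sums_iff matrix_matrix_mult_def)
  qed
  ultimately show ?thesis by simp
qed

text \<open>Transposition reverses products, and each power of a matrix commutes with that
  matrix.\<close>

lemma transpose_mat_exp:
  fixes A :: "real^'n^'n"
  shows "transpose (mat_exp A) = mat_exp (transpose A)"
proof -
  have comm: "(((**) B) ^^ k) (mat 1) ** B = B ** (((**) B) ^^ k) (mat 1)" for B :: "real^'n^'n" and k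
    by (induction k) (simp_all add: matrix_mul_assoc[symmetric])
  have tr: "transpose ((((**) A) ^^ k) (mat 1)) = (((**) (transpose A)) ^^ k) (mat 1)" for k
    by (induction k) (simp_all add: matrix_transpose_mul comm)
  have "mat_exp A $ j $ i = mat_exp (transpose A) $ i $ j" for i j
    using mat_exp_nth_sums[of A j i 1] mat_exp_nth_sums[of "transpose A" i j 1] tr
    by (simp add: sums_iff transpose_def vec_eq_iff)
  then show ?thesis
    by (simp add: transpose_def vec_eq_iff)
qed

section \<open>The trajectory and the systems that it solves\<close>

lemma trajectory_has_vector_derivative:
  fixes X :: "real^'n^'n"
  shows "(trajectory X x0 has_vector_derivative X *v trajectory X x0 t) (at t within S)"
proof -
  have "((\<lambda>t. \<Sum>j\<in>UNIV. mat_exp (t *\<^sub>R X) $ i $ j * x0 $ j) has_real_derivative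
      (\<Sum>j\<in>UNIV. (X ** mat_exp (t *\<^sub>R X)) $ i $ j * x0 $ j)) (at t within S)" for i
    by (intro DERIV_sum DERIV_cmult_right
        has_field_derivative_at_within[OF mat_exp_nth_has_derivative])
  then have "((\<lambda>t. \<chi> i. \<Sum>j\<in>UNIV. mat_exp (t *\<^sub>R X) $ i $ j * x0 $ j) has_vector_derivative
      (\<chi> i. \<Sum>j\<in>UNIV. (X ** mat_exp (t *\<^sub>R X)) $ i $ j * x0 $ j)) (at t within S)"
    unfolding has_vector_derivative_def
    by (subst has_derivative_componentwise_within)
       (auto simp: Basis_vec_def inner_axis has_field_derivative_def mult_commute_abs)
  then show ?thesis
    by (simp only: trajectory_def[abs_def] matrix_vector_mul_assoc) (simp only: matrix_vector_mult_def)
qed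

text \<open>Derivatives within a nondegenerate closed interval are unique, endpoints included, so
  \<open>Y\<close> and \<open>X\<close> must agree along the trajectory.\<close>

lemma solves_on_trajectory_iff:
  assumes "T > 0"
  shows "solves_on T Y (trajectory X x0) \<longleftrightarrow> (\<forall>t\<in>{0..T}. (Y - X) *v trajectory X x0 t = 0)"
proof -
  have "((trajectory X x0 has_vector_derivative Y *v trajectory X x0 t) (at t within {0..T}))
      \<longleftrightarrow> (Y - X) *v trajectory X x0 t = 0" if "t \<in> {0..T}" for t
    using vector_derivative_unique_within_closed_interval[OF assms, of t]
      trajectory_has_vector_derivative[of X x0 t "{0..T}"] that
    by (force simp: matrix_vector_mult_diff_rdistrib)
  then show ?thesis
    by (simp add: solves_on_def)
qed

text \<open>The graph is free to vary, so each symmetric matrix is reached through the graph of its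
  own nonzero off-diagonal entries.\<close>

lemma im_qual_class: "im_graph_map qual_class = (sym_matrices :: (real^'n::finite^'n) set)"
proof -
  have "\<exists>G\<in>simple_graphs. Y \<in> qual_class G" if Y: "Y \<in> sym_matrices" for Y :: "real^'n^'n"
  proof -
    define G :: "'n pair_pre_digraph"
      where "G = \<lparr>pverts = UNIV, parcs = {(i, j). i \<noteq> j \<and> Y $ i $ j \<noteq> 0}\<rparr>"
    have sym: "Y $ i $ j = Y $ j $ i" for i j
      using Y by (simp add: sym_matrices_def transpose_def vec_eq_iff)
    have "pair_graph G"
      by unfold_locales (auto simp: G_def symmetric_def sym_def arcs_ends_def arc_to_ends_def sym)
    then show ?thesis
      using Y by (intro bexI[of _ G]) (auto simp: simple_graphs_def qual_class_def G_def)
  qed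
  then show ?thesis
    by (auto simp: im_graph_map_def)
qed

section \<open>Outer products\<close>

lemma outer_prod_mult:
  fixes A B :: "real^'n^'n"
  shows "A ** outer_prod x y ** B = outer_prod (A *v x) (transpose B *v y)"
  by (simp add: outer_prod_def matrix_matrix_mult_def matrix_vector_mult_def transpose_def
      vec_eq_iff sum_distrib_left sum_distrib_right mult_ac)

lemma matrix_mult_outer_prod: "A ** outer_prod x y = outer_prod (A *v x) y"
  for A :: "real^'n^'n"
  using outer_prod_mult[of A x y "mat 1"] by simp

lemma outer_prod_matrix_mult: "outer_prod x y ** A = outer_prod x (transpose A *v y)"
  for A :: "real^'n^'n"
  using outer_prod_mult[of "mat 1" x y A] by simp

lemma outer_prod_vector_mult: "outer_prod x y *v z = (y \<bullet> z) *\<^sub>R x"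
  by (simp add: outer_prod_def matrix_vector_mult_def inner_vec_def vec_eq_iff
      sum_distrib_left mult_ac)

text \<open>Supplies continuity and the product rule for
  \<open>outer_prod (x t) (x t)\<close>.\<close>

lemma bounded_bilinear_outer_prod: "bounded_bilinear (outer_prod :: real^'n \<Rightarrow> _)"
  unfolding bilinear_conv_bounded_bilinear[symmetric] bilinear_def
  by (auto intro!: linearI simp: outer_prod_def vec_eq_iff algebra_simps)

text \<open>The two traces are sums of the quadratic form of \<open>P\<close> over the columns and
  over the rows of \<open>S\<close>. Both are nonnegative and they add up to zero, so every column
  vanishes.\<close>

lemma lyapunov_kernel_trivial:
  fixes P S :: "real^'n^'n"
  assumes pos: "\<And>v. v \<noteq> 0 \<Longrightarrow> v \<bullet> (P *v v) > 0"
    and eq: "S ** P + P ** S = 0"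
  shows "S = 0"
proof -
  have nonneg: "v \<bullet> (P *v v) \<ge> 0" for v
    using pos[of v] by (cases "v = 0") auto
  have 1: "trace (transpose S ** (P ** S)) = (\<Sum>j\<in>UNIV. column j S \<bullet> (P *v column j S))"
    by (simp add: trace_def matrix_matrix_mult_def matrix_vector_mult_def transpose_def
        column_def inner_vec_def)
  \<comment> \<open>Cyclic invariance puts \<open>P\<close> between \<open>S\<close> and its
    transpose, which exposes the rows.\<close>
  have "trace (transpose S ** (S ** P)) = trace (S ** (P ** transpose S))"
    by (metis trace_mul_sym matrix_mul_assoc)
  also have "\<dots> = (\<Sum>i\<in>UNIV. row i S \<bullet> (P *v row i S))"
    by (simp add: trace_def matrix_matrix_mult_def matrix_vector_mult_def transpose_def
        row_def inner_vec_def)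
  finally have 2: "trace (transpose S ** (S ** P)) \<ge> 0"
    by (simp add: nonneg sum_nonneg)
  have "trace (transpose S ** (S ** P)) + trace (transpose S ** (P ** S)) = trace (0 :: real^'n^'n)"
    unfolding trace_add[symmetric] matrix_add_ldistrib[symmetric] eq by simp
  then have "(\<Sum>j\<in>UNIV. column j S \<bullet> (P *v column j S)) \<le> 0"
    using 1 2 by (simp add: trace_def)
  then have "column j S \<bullet> (P *v column j S) = 0" for j
    using sum_nonneg_eq_0_iff[of UNIV "\<lambda>j. column j S \<bullet> (P *v column j S)"] nonneg
    by (simp add: antisym sum_nonneg)
  then have "column j S = 0" for j
    using pos[of "column j S"] by force
  then show ?thesis
    by (simp add: column_def vec_eq_iff)
qed

section \<open>Solvability, injectivity along the trajectory and the Lyapunov kernel\<close>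

theorem corollary9:
  fixes T :: real and G :: "'n::finite pair_pre_digraph"
    and X P Q :: "real^'n^'n" and x0 xT :: "real^'n"
  assumes "T > 0"
    and "G \<in> simple_graphs"
    and "X \<in> qual_class G"
    and "P = integral {0..T} (\<lambda>t. mat_exp (t *\<^sub>R X) ** outer_prod x0 x0 ** mat_exp (t *\<^sub>R X))"
    and "xT = mat_exp (T *\<^sub>R X) *v x0"
    and "Q = outer_prod xT xT - outer_prod x0 x0"
  shows "(reconstruction_solvable T x0 X qual_class \<longleftrightarrow> (\<exists>!S::real^'n^'n. S ** P + P ** S = Q))
    \<and> ((\<exists>!S::real^'n^'n. S ** P + P ** S = Q) \<longrightarrow>
        (\<forall>S::real^'n^'n. S ** P + P ** S = Q \<longrightarrow> S = X))"
proof -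
  have symX: "transpose X = X"
    using assms(3) by (simp add: qual_class_def sym_matrices_def)
  define x where "x = trajectory X x0"
  note deriv = trajectory_has_vector_derivative[of X x0, folded x_def]
  have cont: "continuous_on {0..T} x"
    by (rule continuous_on_vector_derivative[OF deriv])
  have x0: "x 0 = x0"
  proof -
    have "mat_exp (0 *\<^sub>R X) $ i $ j = (mat 1 :: real^'n^'n) $ i $ j" for i j
      using mat_exp_nth_sums[of X i j 0] powser_sums_zero[of "\<lambda>k. ((((**) X) ^^ k) (mat 1)) $ i $ j / fact k"]
      by (simp add: sums_iff)
    then have "mat_exp (0 *\<^sub>R X) = mat 1"
      by (simp only: vec_eq_iff) auto
    then show ?thesis
      by (simp add: x_def trajectory_def)
  qed
  \<comment> \<open>Since \<open>X\<close> is symmetric, so is its exponential, and the right factor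
    also acts on \<open>x0\<close>.\<close>
  have integrand: "mat_exp (t *\<^sub>R X) ** outer_prod x0 x0 ** mat_exp (t *\<^sub>R X) = outer_prod (x t) (x t)" for t
    by (simp add: outer_prod_mult x_def trajectory_def transpose_mat_exp transpose_scalar symX)
  have P: "((\<lambda>t. outer_prod (x t) (x t)) has_integral P) {0..T}"
    unfolding assms(4) integrand
    by (intro integrable_integral integrable_continuous_interval
        bounded_bilinear.continuous_on[OF bounded_bilinear_outer_prod] cont)

  have "((\<lambda>t. outer_prod (x t) (X *v x t) + outer_prod (X *v x t) (x t))
      has_integral outer_prod (x T) (x T) - outer_prod (x 0) (x 0)) {0..T}"
    using assms(1)
    by (intro fundamental_theorem_of_calculus
        bounded_bilinear.has_vector_derivative[OF bounded_bilinear_outer_prod] deriv) auto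
  \<comment> \<open>The same integrand with \<open>X\<close> factored out: linearity moves
    \<open>X\<close> outside the integral, and the two values must coincide.\<close>
  moreover have "((\<lambda>t. X ** outer_prod (x t) (x t) + outer_prod (x t) (x t) ** X)
      has_integral (X ** P + P ** X)) {0..T}"
    using P by (intro has_integral_add
        has_integral_linear[OF _ bounded_linear_matrix_mult_left, unfolded o_def]
        has_integral_linear[OF _ bounded_linear_matrix_mult_right, unfolded o_def])
  ultimately have X_sol: "X ** P + P ** X = Q"
    using x0 unfolding matrix_mult_outer_prod outer_prod_matrix_mult symX
    by (auto simp: assms(5,6) x_def trajectory_def add.commute intro: has_integral_unique)

  \<comment> \<open>Substitute \<open>D = Y - X\<close>; as \<open>X\<close> is symmetric,
    \<open>D\<close> ranges over all symmetric matrices.\<close>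
  have solvable_iff: "reconstruction_solvable T x0 X qual_class
      \<longleftrightarrow> (\<forall>D\<in>sym_matrices. (\<forall>t\<in>{0..T}. D *v x t = 0) \<longrightarrow> D = 0)" (is "?solvable \<longleftrightarrow> ?inj")
  proof -
    have [simp]: "D + X \<in> sym_matrices \<longleftrightarrow> D \<in> sym_matrices"
      and sym_diff: "D - X \<in> sym_matrices \<longleftrightarrow> D \<in> sym_matrices" for D
      using symX by (auto simp: sym_matrices_def transpose_def vec_eq_iff)
    have "?solvable \<longleftrightarrow> (\<forall>Y\<in>sym_matrices. (\<forall>t\<in>{0..T}. (Y - X) *v x t = 0) \<longrightarrow> Y = X)"
      by (simp add: reconstruction_solvable_def im_qual_class
          solves_on_trajectory_iff[OF assms(1)] x_def)
    also have "\<dots> \<longleftrightarrow> ?inj"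
    proof (intro iffI ballI impI)
      fix D assume "\<forall>Y\<in>sym_matrices. (\<forall>t\<in>{0..T}. (Y - X) *v x t = 0) \<longrightarrow> Y = X"
        "D \<in> sym_matrices" "\<forall>t\<in>{0..T}. D *v x t = 0"
      then show "D = 0"
        by (auto dest: bspec[of _ _ "D + X"])
    next
      fix Y assume "?inj" "Y \<in> sym_matrices" "\<forall>t\<in>{0..T}. (Y - X) *v x t = 0"
      then have "Y - X = 0"
        using sym_diff by blast
      then show "Y = X" by simp
    qed
    finally show ?thesis .
  qed

  \<comment> \<open>The solution set is \<open>X\<close> plus the kernel of the linear map sending
    \<open>S\<close> to \<open>S ** P + P ** S\<close>.\<close>
  have unique_iff: "(\<exists>!S. S ** P + P ** S = Q) \<longleftrightarrow> (\<forall>S. S ** P + P ** S = 0 \<longrightarrow> S = 0)"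
  proof (intro iffI allI impI)
    fix S assume uniq: "\<exists>!S. S ** P + P ** S = Q" and S: "S ** P + P ** S = 0"
    have "(X + S) ** P + P ** (X + S) = (X ** P + P ** X) + (S ** P + P ** S)"
      using linear_add[OF bounded_linear.linear[OF bounded_linear_matrix_mult_right], of X S P]
      by (simp add: matrix_add_ldistrib)
    then have "(X + S) ** P + P ** (X + S) = Q"
      by (simp only: X_sol S add_0_right)
    then have "X + S = X"
      using uniq X_sol by blast
    then show "S = 0" by simp
  next
    assume ker: "\<forall>S. S ** P + P ** S = 0 \<longrightarrow> S = 0"
    show "\<exists>!S. S ** P + P ** S = Q"
    proof (rule ex1I[of _ X], rule X_sol)
      fix S assume S: "S ** P + P ** S = Q"
      have "(S - X) ** P + P ** (S - X) = (S ** P + P ** S) - (X ** P + P ** X)"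
        using linear_diff[OF bounded_linear.linear[OF bounded_linear_matrix_mult_left], of P S X]
          linear_diff[OF bounded_linear.linear[OF bounded_linear_matrix_mult_right], of S X P]
        by simp
      then have "(S - X) ** P + P ** (S - X) = 0"
        by (simp only: S X_sol diff_self)
      then have "S - X = 0" using ker by blast
      then show "S = X" by simp
    qed
  qed

  have "(\<forall>D\<in>sym_matrices. (\<forall>t\<in>{0..T}. D *v x t = 0) \<longrightarrow> D = 0)
      \<longleftrightarrow> (\<forall>S. S ** P + P ** S = 0 \<longrightarrow> S = 0)" (is "?inj \<longleftrightarrow> _")
  proof (intro iffI allI ballI impI)
    fix S assume inj: ?inj and S: "S ** P + P ** S = 0"
    have "v \<bullet> (P *v v) > 0" if "v \<noteq> 0" for v
    proof -
      \<comment> \<open>The form at a fixed \<open>v\<close> is linear in the matrix, so it passes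
        under the integral defining \<open>P\<close>.\<close>
      have "bounded_linear (\<lambda>M::real^'n^'n. v \<bullet> (M *v v))"
        unfolding linear_conv_bounded_linear[symmetric]
        by (intro linearI)
           (simp_all add: matrix_vector_mult_add_rdistrib inner_add_right scaleR_matrix_vector_assoc[symmetric])
      from has_integral_linear[OF P this]
      have int: "((\<lambda>t. (v \<bullet> x t)\<^sup>2) has_integral v \<bullet> (P *v v)) {0..T}"
        by (simp add: o_def outer_prod_vector_mult power2_eq_square inner_commute)
      then have "v \<bullet> (P *v v) \<ge> 0"
        by (rule has_integral_nonneg) simp
      moreover have "v \<bullet> (P *v v) \<noteq> 0"
      proof
        assume "v \<bullet> (P *v v) = 0"
        then have "((\<lambda>t. (v \<bullet> x t)\<^sup>2) has_integral 0) (cbox 0 T)"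
          using int by simp
        \<comment> \<open>A continuous nonnegative function with zero integral over a nondegenerate
          interval vanishes pointwise.\<close>
        then have "(v \<bullet> x t)\<^sup>2 = 0" if "t \<in> {0..T}" for t
          using that assms(1)
          by (intro has_integral_0_cbox_imp_0[of 0 T "\<lambda>t. (v \<bullet> x t)\<^sup>2"])
             (auto intro!: continuous_intros cont)
        then have "\<forall>t\<in>{0..T}. outer_prod v v *v x t = 0"
          by (simp add: outer_prod_vector_mult)
        moreover have "outer_prod v v \<in> sym_matrices"
          by (simp add: sym_matrices_def outer_prod_def transpose_def mult.commute)
        ultimately have "outer_prod v v = 0"
          using inj by blast
        \<comment> \<open>Apply the zero matrix \<open>outer_prod v v\<close> to \<open>v\<close>
          itself.\<close>
        then have "(v \<bullet> v) *\<^sub>R v = 0"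
          by (simp flip: outer_prod_vector_mult)
        then show False using \<open>v \<noteq> 0\<close> by simp
      qed
      ultimately show ?thesis by simp
    qed
    then show "S = 0"
      using S by (rule lyapunov_kernel_trivial)
  next
    fix D assume ker: "\<forall>S. S ** P + P ** S = 0 \<longrightarrow> S = 0"
      and D: "D \<in> sym_matrices" "\<forall>t\<in>{0..T}. D *v x t = 0"
    have "((\<lambda>t. D ** outer_prod (x t) (x t) + outer_prod (x t) (x t) ** D)
        has_integral (D ** P + P ** D)) {0..T}"
      using P by (intro has_integral_add
          has_integral_linear[OF _ bounded_linear_matrix_mult_left, unfolded o_def]
          has_integral_linear[OF _ bounded_linear_matrix_mult_right, unfolded o_def])
    \<comment> \<open>By symmetry of \<open>D\<close>, each product is an outer product with
      \<open>D *v x t = 0\<close> as one factor.\<close>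
    moreover have "D ** outer_prod (x t) (x t) + outer_prod (x t) (x t) ** D = 0"
      if "t \<in> {0..T}" for t
      using D that
      by (simp add: matrix_mult_outer_prod outer_prod_matrix_mult sym_matrices_def
          bounded_bilinear.zero_left[OF bounded_bilinear_outer_prod]
          bounded_bilinear.zero_right[OF bounded_bilinear_outer_prod])
    ultimately have "((\<lambda>t. 0) has_integral (D ** P + P ** D)) {0..T}"
      by (rule has_integral_eq[rotated])
    then have "D ** P + P ** D = 0"
      by (rule has_integral_unique) simp
    then show "D = 0" using ker by blast
  qed
  \<comment> \<open>As \<open>X\<close> is a solution, uniqueness also yields the final claim
    \<open>S = X\<close>.\<close>
  then show ?thesis
    using solvable_iff unique_iff X_sol by blast
qed

end
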